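(* Let $n>1$ be an integer. If $n$ is prime, then $\Pi_n=c_n$. If $n$ is composite, then $$\Pi_n=\sum_{s=1}^{\Omega(n)}\ \sum_{\substack{k_1,\ldots,k_s>1\\ k_1\cdots k_s=n}}(-1)^{s+1}c_{k_1}\cdots c_{k_s},$$ where the inner sum runs over ordered $s$-tuples of integers $k_i>1$ with product $n$ (so that the term for $s=1$ is $c_n$).
   Context: $\mathbb{M}$ is the free magma on one generator $1$ (its elements are identified with finite full binary trees), with operation $+$. The length $\ell:\mathbb{M}\to\mathbb{N}$ is defined by $\ell(1)=1$, $\ell(x+y)=\ell(x)+\ell(y)$ (number of leaves). The product on $\mathbb{M}$ is the unique operation with $x\cdot1=1\cdot x=x$ and $x\cdot(y+z)=x\cdot y+x\cdot z$. An element $a$ divides $x$, written $a|x$, iff $x=ay$ for some $y\in\mathbb{M}$. An element $x\neq1$ is prime iff its only divisors are $1$ and $x$; $1$ is not counted as prime. $\Pi_n$ denotes the number of prime elements of $\mathbb{M}$ of length $n$. $c_n=C_{n-1}$, where $C_m=\frac1{m+1}\binom{2m}{m}$ is the $m$-th Catalan number. $\Omega(n)$ is the number of prime factors of the integer $n$ counted with multiplicity. *)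

theory Defs
  imports "HOL-Computational_Algebra.Computational_Algebra"
begin

text \<open>The free magma on one generator, presented as the full binary trees: the generator is
  the one-leaf tree and the magma operation joins two trees at a new root.\<close>

datatype magma = Gen | Join magma magma

instantiation magma :: "{one, plus, Rings.dvd}"
begin

definition one_magma :: magma where
  "1 = Gen"

definition plus_magma :: "magma \<Rightarrow> magma \<Rightarrow> magma" where
  "x + y = Join x y"

primrec times_magma :: "magma \<Rightarrow> magma \<Rightarrow> magma" where
  "x * Gen = x"
| "x * Join y z = x * y + x * z"

instance ..

end

lemma magma_mult_one_right: "x * 1 = (x :: magma)"
  by (simp add: one_magma_def)

lemma magma_mult_one_left: "1 * x = (x :: magma)"
  by (induction x) (simp_all add: one_magma_def plus_magma_def)

lemma magma_mult_plus: "x * (y + z) = x * y + x * (z :: magma)"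
  by (simp add: plus_magma_def)

lemma magma_mult_unique:
  fixes f :: "magma \<Rightarrow> magma \<Rightarrow> magma"
  assumes "\<And>x. f x 1 = x" and "\<And>x y z. f x (y + z) = f x y + f x z"
  shows "f x y = x * y"
proof (induction y)
  case Gen
  then show ?case using assms(1) by (simp add: one_magma_def)
next
  case (Join y z)
  then show ?case using assms(2)[of x y z] by (simp add: plus_magma_def)
qed

primrec leaves :: "magma \<Rightarrow> nat" where
  "leaves Gen = 1"
| "leaves (Join x y) = leaves x + leaves y"

lemma leaves_one: "leaves 1 = 1"
  by (simp add: one_magma_def)

lemma leaves_plus: "leaves (x + y) = leaves x + leaves y"
  by (simp add: plus_magma_def)

text \<open>The product is not commutative. Divisibility \<open>a dvd x\<close> is the library relation of class
  \<open>dvd\<close>, i.e. \<open>\<exists>y. x = a * y\<close>: \<open>a\<close> is the left factor. The library's \<open>prime\<close> is only available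
  over commutative semirings.\<close>

definition magma_prime :: "magma \<Rightarrow> bool" where
  "magma_prime x \<longleftrightarrow> x \<noteq> 1 \<and> {a. a dvd x} = {1, x}"

definition num_primes :: "nat \<Rightarrow> nat" where
  "num_primes n = card {x. magma_prime x \<and> leaves x = n}"

lemma leaves_pos: "leaves x > 0"
  by (induction x) simp_all

text \<open>The cardinality in \<open>num_primes\<close> is that of a finite set.\<close>

lemma finite_leaves_le: "finite {x. leaves x \<le> n}"
proof (induction n)
  case 0
  have "{x. leaves x \<le> 0} = {}"
    using leaves_pos by (metis (no_types, lifting) empty_Collect_eq not_le)
  then show ?case by (simp only: finite.emptyI)
next
  case (Suc n)
  have "{x. leaves x \<le> Suc n} \<subseteq>
      insert Gen ((\<lambda>(x, y). Join x y) ` ({x. leaves x \<le> n} \<times> {x. leaves x \<le> n}))"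
  proof
    fix x assume x: "x \<in> {x. leaves x \<le> Suc n}"
    show "x \<in> insert Gen ((\<lambda>(x, y). Join x y) ` ({x. leaves x \<le> n} \<times> {x. leaves x \<le> n}))"
    proof (cases x)
      case (Join y z)
      then show ?thesis using x leaves_pos[of y] leaves_pos[of z] by auto
    qed simp
  qed
  then show ?case using Suc finite_subset by blast
qed

lemma finite_magma_primes: "finite {x. magma_prime x \<and> leaves x = n}"
  by (rule finite_subset[OF _ finite_leaves_le[of n]]) auto

text \<open>The division below is exact, see \<open>of_nat_catalan\<close>.\<close>

definition catalan :: "nat \<Rightarrow> nat" where
  "catalan m = ((2 * m) choose m) div (m + 1)"

lemma Suc_dvd_central_binomial: "Suc m dvd ((2 * m) choose m)"
proof -
  have "Suc m * ((2 * m) choose Suc m) = (2 * m - m) * ((2 * m) choose m)"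
    by (simp only: binomial_absorb_comp binomial_absorption)
  then have "Suc m dvd m * ((2 * m) choose m)"
    by (metis add_diff_cancel_right' dvd_triv_left mult_2)
  moreover have "coprime (Suc m) m"
    by simp
  ultimately show ?thesis
    by (simp add: coprime_dvd_mult_right_iff)
qed

lemma of_nat_catalan:
  "(of_nat (catalan m) :: 'a :: field_char_0) = 1 / of_nat (m + 1) * of_nat ((2 * m) choose m)"
proof -
  have "catalan m * (m + 1) = (2 * m) choose m"
    unfolding catalan_def using Suc_dvd_central_binomial[of m] by (metis Suc_eq_plus1 dvd_div_mult_self)
  then have "of_nat (catalan m) * of_nat (m + 1) = (of_nat ((2 * m) choose m) :: 'a)"
    by (metis of_nat_mult)
  then show ?thesis
    by (simp add: field_simps del: of_nat_add of_nat_Suc)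
qed

text \<open>Used only for \<open>n \<ge> 1\<close>; the value at \<open>0\<close> is an artefact of truncated subtraction.\<close>

definition cnum :: "nat \<Rightarrow> nat" where
  "cnum n = catalan (n - 1)"

definition Omega :: "nat \<Rightarrow> nat" where
  "Omega n = size (prime_factorization n)"

definition factorizations :: "nat \<Rightarrow> nat \<Rightarrow> nat list set" where
  "factorizations s n = {ks. length ks = s \<and> (\<forall>k\<in>set ks. k > 1) \<and> prod_list ks = n}"

text \<open>Sums over \<open>factorizations s n\<close> are thus finite sums.\<close>

lemma finite_factorizations:
  assumes "n > 0"
  shows "finite (factorizations s n)"
proof -
  have "factorizations s n \<subseteq> {ks. set ks \<subseteq> {..n} \<and> length ks = s}"
  proof
    fix ks assume ks: "ks \<in> factorizations s n"
    have "k \<le> n" if "k \<in> set ks" for k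
    proof (rule dvd_imp_le)
      show "k dvd n"
        using that ks by (auto simp: factorizations_def in_set_conv_decomp)
    qed (use assms in simp)
    with ks show "ks \<in> {ks. set ks \<subseteq> {..n} \<and> length ks = s}"
      by (auto simp: factorizations_def)
  qed
  then show ?thesis
    using finite_lists_length_eq[of "{..n}" s] finite_subset by blast
qed

end

theory Submission
  imports Defs
begin

text \<open>The left divisors of a tree form a chain, so every tree other than \<open>1\<close> is \<open>p * y\<close>
  for exactly one prime \<open>p\<close>, and \<open>y\<close> is determined by left cancellation. Counting trees by the
  length of \<open>p\<close> gives \<open>c\<^sub>n = (\<Sum>d | d dvd n \<and> d > 1. \<Pi>\<^sub>d c\<^bsub>n div d\<^esub>)\<close>. Splitting off the first entry
  of a factorization of \<open>n\<close> shows that the signed sum over factorizations obeys the same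
  recurrence. Trees are counted by Catalan numbers because their generating function \<open>T\<close>
  satisfies \<open>T = X + T\<^sup>2\<close>, so that \<open>S = 1 - 2 T\<close> has \<open>S\<^sup>2 = 1 - 4 X\<close>, whence \<open>(1 - 4 X) S' = - 2 S\<close>.\<close>

section \<open>Divisibility of trees\<close>

lemma leaves_mult: "leaves (x * y) = leaves x * leaves y"
  by (induction y) (simp_all add: plus_magma_def algebra_simps)

lemma leaves_eq_1_iff: "leaves x = 1 \<longleftrightarrow> x = 1"
proof (cases x)
  case (Join y z)
  then show ?thesis
    using leaves_pos[of y] leaves_pos[of z] by (simp add: one_magma_def)
qed (simp add: one_magma_def)

lemma magma_mult_assoc: "(x * y) * z = x * (y * z :: magma)"
  by (induction z) (simp_all add: plus_magma_def)

text \<open>Comparing lengths shows that one of \<open>y\<close>, \<open>z\<close> is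
  \<open>1\<close> exactly when the other is. Otherwise both products are joins, and their halves
  must agree.\<close>

lemma magma_mult_left_cancel: "x * y = x * z \<longleftrightarrow> y = (z :: magma)"
proof
  assume "x * y = x * z"
  then show "y = z"
  proof (induction y arbitrary: z)
    case Gen
    then have "leaves x * leaves z = leaves x * 1"
      by (metis leaves_mult leaves.simps(1))
    then have "leaves z = 1"
      using leaves_pos[of x] by simp
    then show ?case
      by (metis leaves_eq_1_iff one_magma_def)
  next
    case (Join y1 y2)
    show ?case
    proof (cases z)
      case Gen
      then have "leaves x * leaves (Join y1 y2) = leaves x * 1"
        using Join.prems by (metis leaves_mult leaves.simps(1))
      then have "leaves (Join y1 y2) = 1"
        using leaves_pos[of x] by (metis mult_cancel1 less_irrefl)
      then show ?thesis
        by (metis leaves_eq_1_iff one_magma_def magma.distinct(1))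
    next
      case (Join z1 z2)
      then show ?thesis
        using Join.IH Join.prems by (simp add: plus_magma_def)
    qed
  qed
qed simp

text \<open>As long as both cofactors are joins, the equation passes to the left halves
  \<open>a * y1 = b * z1\<close>. Once one cofactor has shrunk to \<open>Gen\<close>, the equation
  itself is a divisibility.\<close>

lemma magma_dvd_chain:
  fixes a b :: magma
  assumes "a * y = b * z"
  shows "a dvd b \<or> b dvd a"
  using assms
proof (induction y arbitrary: z)
  case Gen
  then show ?case by (auto simp: dvd_def)
next
  case (Join y1 y2)
  show ?case
  proof (cases z)
    case Gen
    then show ?thesis using Join.prems by (metis dvd_def times_magma.simps(1))
  next
    case (Join z1 z2)
    then show ?thesis
      using Join.IH(1)[of z1] Join.prems by (simp add: plus_magma_def)
  qed
qed

lemma magma_prime_not_one: "magma_prime p \<Longrightarrow> p \<noteq> 1"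
  by (simp add: magma_prime_def)

lemma magma_prime_dvdD: "magma_prime p \<Longrightarrow> a dvd p \<Longrightarrow> a = 1 \<or> a = p"
  by (auto simp: magma_prime_def)

lemma magma_prime_divisor_unique:
  assumes "magma_prime p" "magma_prime q" "p * y = q * z"
  shows "p = q \<and> y = z"
proof -
  have "p = q"
    using magma_dvd_chain[OF assms(3)] assms(1,2) magma_prime_dvdD magma_prime_not_one by metis
  then show ?thesis
    using assms(3) by (simp add: magma_mult_left_cancel)
qed

text \<open>A nontrivial divisor of \<open>x\<close> is shorter than \<open>x\<close>, and by
  associativity its prime left factor is also one of \<open>x\<close>.\<close>

lemma magma_prime_divisor_exists:
  assumes "x \<noteq> 1"
  shows "\<exists>p y. magma_prime p \<and> x = p * y"
  using assms
proof (induction "leaves x" arbitrary: x rule: less_induct)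
  case less
  show ?case
  proof (cases "magma_prime x")
    case True
    then show ?thesis by (metis magma_mult_one_right)
  next
    case False
    have "1 dvd x" "x dvd x"
      by (metis dvd_def magma_mult_one_left, metis dvd_def magma_mult_one_right)
    then obtain a where a: "a dvd x" "a \<noteq> 1" "a \<noteq> x"
      using False less.prems by (auto simp: magma_prime_def)
    then obtain b where b: "x = a * b"
      by (auto simp: dvd_def)
    then have "b \<noteq> 1"
      using a(3) by (metis magma_mult_one_right)
    then have "leaves b > 1"
      using leaves_eq_1_iff[of b] leaves_pos[of b] by linarith
    then have "leaves a < leaves x"
      using leaves_pos[of a] by (simp add: b leaves_mult)
    then obtain p y where "magma_prime p" "a = p * y"
      using less.hyps a(2) by blast
    then show ?thesis
      using b magma_mult_assoc by blast
  qed
qed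

section \<open>Counting trees\<close>

definition num_trees :: "nat \<Rightarrow> nat" where
  "num_trees n = card {x. leaves x = n}"

lemma finite_trees: "finite {x. leaves x = n}"
  by (rule finite_subset[OF _ finite_leaves_le[of n]]) auto

lemma num_trees_0: "num_trees 0 = 0"
proof -
  have "{x. leaves x = 0} = {}"
    using leaves_pos by (simp add: less_imp_neq)
  then show ?thesis by (simp only: num_trees_def card.empty)
qed

lemma num_trees_1: "num_trees 1 = 1"
proof -
  have "{x. leaves x = 1} = {1}"
    by (auto simp only: leaves_eq_1_iff)
  then show ?thesis by (simp add: num_trees_def)
qed

text \<open>Every tree counted here is the join of two determined halves. The end terms of the sum
  vanish, and keeping them gives the shape of a Cauchy product.\<close>

lemma num_trees_Join:
  assumes "n \<noteq> 1"
  shows "num_trees n = (\<Sum>i\<le>n. num_trees i * num_trees (n - i))"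
proof -
  let ?S = "SIGMA i:{..n}. {x. leaves x = i} \<times> {y. leaves y = n - i}"
  have "bij_betw (\<lambda>(i, x, y). Join x y) ?S {x. leaves x = n}"
    unfolding bij_betw_def
  proof
    show "inj_on (\<lambda>(i, x, y). Join x y) ?S"
      by (auto simp: inj_on_def)
    show "(\<lambda>(i, x, y). Join x y) ` ?S = {x. leaves x = n}"
    proof (intro equalityI subsetI)
      fix x assume "x \<in> {x. leaves x = n}"
      then have x: "leaves x = n" by simp
      with assms obtain y z where yz: "x = Join y z"
        by (cases x) auto
      with x have "(leaves y, y, z) \<in> ?S"
        by auto
      then show "x \<in> (\<lambda>(i, x, y). Join x y) ` ?S"
        using yz by force
    qed auto
  qed
  then have "num_trees n = card ?S"
    by (simp add: num_trees_def bij_betw_same_card)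
  also have "\<dots> = (\<Sum>i\<le>n. num_trees i * num_trees (n - i))"
    by (subst card_SigmaI) (auto simp: finite_trees num_trees_def card_cartesian_product)
  finally show ?thesis .
qed

section \<open>The generating function of the tree counts\<close>

lemma num_trees_recurrence:
  assumes "n \<ge> 1"
  shows "(n + 1) * num_trees (n + 1) = (4 * n - 2) * num_trees n"
proof -
  \<comment> \<open>Integer coefficients allow the subtraction in \<open>S\<close>, a square root of
    the discriminant \<open>1 - 4 * fps_X\<close> of the quadratic equation for
    \<open>T\<close>.\<close>
  define T :: "int fps" where "T = Abs_fps (\<lambda>n. int (num_trees n))"
  define S where "S = 1 - 2 * T"
  have "T = fps_X + T * T"
  proof (rule fps_ext)
    fix n show "T $ n = (fps_X + T * T) $ n"
    proof (cases "n = 1")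
      case True
      then show ?thesis
        by (simp add: T_def fps_mult_nth num_trees_0 num_trees_1[simplified])
    next
      case False
      then show ?thesis
        by (simp add: T_def fps_mult_nth num_trees_Join[OF False] atLeast0AtMost)
    qed
  qed
  then have X: "fps_X = T - T * T"
    by (simp add: eq_diff_eq)
  have S_sq: "S * S = 1 - 4 * fps_X"
    unfolding S_def X by (simp add: algebra_simps)
  then have "fps_deriv (S * S) = fps_deriv (1 - 4 * fps_X)"
    by simp
  then have "2 * (S * fps_deriv S) = 2 * (- 2)"
    by (simp add: fps_deriv_numeral algebra_simps)
  then have "S * fps_deriv S = - 2"
    by (simp only: mult_cancel_left) simp
  \<comment> \<open>Multiplying by \<open>S\<close> makes the equation linear in \<open>S\<close>,
    so that comparing coefficients yields a two-term recurrence.\<close>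
  then have "(1 - 4 * fps_X) * fps_deriv S = - 2 * S"
    by (simp flip: S_sq add: mult.assoc mult.left_commute)
  then have "((1 - 4 * fps_X) * fps_deriv S) $ n = (- 2 * S) $ n"
    by simp
  moreover have "((1 - 4 * fps_X) * fps_deriv S) $ n
      = fps_deriv S $ n - 4 * (fps_X * fps_deriv S) $ n"
    by (simp add: left_diff_distrib mult.assoc fps_numeral_nth numeral_fps_const)
  \<comment> \<open>The bound \<open>k \<ge> 1\<close> excludes the constant term, to which the
    summand \<open>1\<close> of \<open>S\<close> contributes.\<close>
  moreover have S_nth: "S $ k = - 2 * int (num_trees k)" if "k \<ge> 1" for k
    using that by (simp add: S_def T_def numeral_fps_const)
  ultimately have "int (n + 1) * int (num_trees (n + 1)) = (4 * int n - 2) * int (num_trees n)"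
    using assms by (simp add: numeral_fps_const S_nth algebra_simps)
  moreover have "4 * int n - 2 = int (4 * n - 2)"
    using assms by simp
  ultimately show ?thesis
    by (metis of_nat_mult of_nat_eq_iff)
qed

section \<open>The Catalan numbers\<close>

lemma central_binomial_Suc:
  "Suc m * ((2 * Suc m) choose Suc m) = 2 * (2 * m + 1) * ((2 * m) choose m)"
proof -
  have "Suc m * ((2 * Suc m) choose Suc m) = Suc (2 * m + 1) * ((2 * m + 1) choose m)"
    using Suc_times_binomial_eq[of "2 * m + 1" m] by (simp add: mult.commute)
  \<comment> \<open>Symmetry of the odd row moves the lower index back to \<open>Suc m\<close>, so
    that absorption applies a second time.\<close>
  also have "(2 * m + 1) choose m = (2 * m + 1) choose Suc m"
    by (subst binomial_symmetric) simp_all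
  also have "Suc (2 * m + 1) * ((2 * m + 1) choose Suc m)
      = 2 * (Suc m * ((2 * m + 1) choose Suc m))"
    by simp
  also have "Suc m * ((2 * m + 1) choose Suc m) = (2 * m + 1) * ((2 * m) choose m)"
    using Suc_times_binomial_eq[of "2 * m" m] by (simp add: mult.commute)
  finally show ?thesis by simp
qed

lemma catalan_mult_Suc: "Suc m * catalan m = (2 * m) choose m"
  unfolding catalan_def Suc_eq_plus1[symmetric]
  by (rule dvd_mult_div_cancel[OF Suc_dvd_central_binomial])

text \<open>This is the recurrence of \<open>num_trees\<close> at \<open>Suc m\<close>; it comes
  from the ratio of consecutive central binomial coefficients.\<close>

lemma catalan_recurrence: "(m + 2) * catalan (Suc m) = (4 * m + 2) * catalan m"
proof -
  have "Suc m * ((m + 2) * catalan (Suc m)) = Suc m * ((2 * Suc m) choose Suc m)"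
    using catalan_mult_Suc[of "Suc m"] by simp
  also have "\<dots> = 2 * (2 * m + 1) * (Suc m * catalan m)"
    by (simp only: central_binomial_Suc catalan_mult_Suc)
  also have "\<dots> = Suc m * ((4 * m + 2) * catalan m)"
    by (simp add: algebra_simps)
  finally show ?thesis by (simp only: mult_cancel1) simp
qed

lemma num_trees_Suc_eq_catalan: "num_trees (Suc m) = catalan m"
proof (induction m)
  case 0
  show ?case using num_trees_1 by (simp add: catalan_def)
next
  case (Suc m)
  have "(m + 2) * num_trees (Suc (Suc m)) = (4 * m + 2) * num_trees (Suc m)"
    using num_trees_recurrence[of "Suc m"] by simp
  also have "\<dots> = (m + 2) * catalan (Suc m)"
    by (simp only: Suc.IH catalan_recurrence)
  finally show ?case by (simp only: mult_cancel1) simp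
qed

lemma num_trees_eq_cnum: "n \<ge> 1 \<Longrightarrow> num_trees n = cnum n"
  using num_trees_Suc_eq_catalan[of "n - 1"] by (simp add: cnum_def)

section \<open>The recurrences\<close>

text \<open>The unique decomposition \<open>p * y\<close> sorts the trees by the length
  \<open>k\<close> of the cofactor \<open>y\<close>; \<open>k < n\<close> says that \<open>p\<close>
  is longer than \<open>1\<close>.\<close>

lemma cnum_eq_sum_num_primes:
  assumes "n > 1"
  shows "cnum n = (\<Sum>k | k dvd n \<and> k < n. cnum k * num_primes (n div k))"
proof -
  let ?K = "{k. k dvd n \<and> k < n}"
  let ?P = "\<lambda>k. {p. magma_prime p \<and> leaves p = n div k}"
  let ?S = "SIGMA k:?K. {y. leaves y = k} \<times> ?P k"
  have "bij_betw (\<lambda>(k, y, p). p * y) ?S {x. leaves x = n}"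
    unfolding bij_betw_def
  proof
    show "inj_on (\<lambda>(k, y, p). p * y) ?S"
    proof (rule inj_onI)
      fix u v
      assume *: "u \<in> ?S" "v \<in> ?S" "(\<lambda>(k, y, p). p * y) u = (\<lambda>(k, y, p). p * y) v"
      obtain k y p k' z q where uv: "u = (k, y, p)" "v = (k', z, q)"
        by (metis prod.exhaust)
      have "p = q \<and> y = z"
        using * uv by (intro magma_prime_divisor_unique) auto
      then show "u = v"
        using * uv by auto
    qed
    show "(\<lambda>(k, y, p). p * y) ` ?S = {x. leaves x = n}"
    proof (intro equalityI subsetI)
      fix x assume "x \<in> {x. leaves x = n}"
      then have x: "leaves x = n" by simp
      then have "x \<noteq> 1"
        using assms leaves_one by auto
      then obtain p y where py: "magma_prime p" "x = p * y"
        using magma_prime_divisor_exists by blast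
      then have n: "n = leaves p * leaves y"
        using x leaves_mult by simp
      have "leaves p \<noteq> 1"
        using py(1) leaves_eq_1_iff magma_prime_not_one by blast
      then have "leaves p > 1"
        using leaves_pos[of p] by linarith
      then have "(leaves y, y, p) \<in> ?S"
        using n py(1) leaves_pos[of y] by simp
      then show "x \<in> (\<lambda>(k, y, p). p * y) ` ?S"
        using py(2) by force
    qed (auto simp: leaves_mult)
  qed
  then have "num_trees n = card ?S"
    by (simp add: num_trees_def bij_betw_same_card)
  also have "\<dots> = (\<Sum>k\<in>?K. num_trees k * num_primes (n div k))"
    by (subst card_SigmaI)
      (auto simp: finite_trees finite_magma_primes num_trees_def num_primes_def
        card_cartesian_product)
  also have "\<dots> = (\<Sum>k\<in>?K. cnum k * num_primes (n div k))"
    using assms dvd_pos_nat[of n] by (intro sum.cong) (auto simp: num_trees_eq_cnum Suc_le_eq)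
  finally show ?thesis
    using assms by (simp add: num_trees_eq_cnum)
qed

lemma cnum_1: "cnum 1 = 1"
  by (simp add: cnum_def catalan_def)

text \<open>The term \<open>k = 1\<close> of the previous sum is \<open>num_primes n\<close> itself,
  because \<open>cnum 1 = 1\<close>.\<close>

lemma num_primes_recurrence:
  assumes "n > 1"
  shows "int (num_primes n)
    = int (cnum n) - (\<Sum>k | k dvd n \<and> 1 < k \<and> k < n. int (cnum k) * int (num_primes (n div k)))"
proof -
  have "{k. k dvd n \<and> k < n} = insert 1 {k. k dvd n \<and> 1 < k \<and> k < n}"
    using assms dvd_pos_nat[of n] by (auto simp: nat_neq_iff)
  then have "cnum n = num_primes n + (\<Sum>k | k dvd n \<and> 1 < k \<and> k < n. cnum k * num_primes (n div k))"
    using cnum_eq_sum_num_primes[OF assms] by (simp add: cnum_1[simplified])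
  then show ?thesis by simp
qed

text \<open>All lengths are taken together, so that splitting off a first entry needs no bookkeeping
  of \<open>s\<close>.\<close>

definition ordered_factorizations :: "nat \<Rightarrow> nat list set" where
  "ordered_factorizations n = {ks. (\<forall>k\<in>set ks. k > 1) \<and> prod_list ks = n}"

text \<open>Each entry contributes at least one prime factor. Hence the range of \<open>s\<close> up
  to \<open>Omega n\<close> captures all factorizations, and there are finitely many.\<close>

lemma length_le_Omega:
  assumes "\<forall>k\<in>set ks. k > 1"
  shows "length ks \<le> Omega (prod_list ks)"
  using assms
proof (induction ks)
  case (Cons k ks)
  have "prod_list ks \<noteq> 0"
    using Cons.prems by (auto simp: prod_list_zero_iff)
  moreover have "prime_factorization k \<noteq> {#}"
    using Cons.prems by (auto simp: prime_factorization_empty_iff)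
  then have "Omega k \<ge> 1"
    by (simp add: Omega_def Suc_le_eq nonempty_has_size)
  ultimately show ?case
    using Cons by (simp add: Omega_def prime_factorization_mult)
qed simp

lemma ordered_factorizations_eq_UN:
  assumes "n > 1"
  shows "ordered_factorizations n = (\<Union>s\<in>{1..Omega n}. factorizations s n)"
  using assms
  by (auto simp: ordered_factorizations_def factorizations_def length_le_Omega Suc_le_eq)

lemma ordered_factorizations_1: "ordered_factorizations 1 = {[]}"
proof -
  have "ks = []" if "ks \<in> ordered_factorizations 1" for ks
    using that length_le_Omega[of ks] by (simp add: ordered_factorizations_def Omega_def)
  then show ?thesis
    by (auto simp: ordered_factorizations_def)
qed

lemma finite_ordered_factorizations:
  assumes "n > 0"
  shows "finite (ordered_factorizations n)"
proof (cases "n = 1")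
  case True
  then show ?thesis by (simp add: ordered_factorizations_1[simplified])
next
  case False
  then show ?thesis
    using assms by (simp add: ordered_factorizations_eq_UN finite_factorizations)
qed

text \<open>The empty list gets weight \<open>- 1\<close>, which lets prepending \<open>k\<close>
  multiply the weight by \<open>- cnum k\<close> without exception.\<close>

definition signed_weight :: "nat list \<Rightarrow> int" where
  "signed_weight ks = (- 1) ^ (length ks + 1) * (\<Prod>k\<leftarrow>ks. int (cnum k))"

lemma signed_weight_Cons: "signed_weight (k # ks) = - int (cnum k) * signed_weight ks"
  by (simp add: signed_weight_def)

lemma sum_signed_weight_1: "sum signed_weight (ordered_factorizations 1) = - 1"
  by (simp add: ordered_factorizations_1[simplified] signed_weight_def)

text \<open>The first entry \<open>k\<close> is split off; what remains is an arbitrary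
  factorization of \<open>n div k\<close>.\<close>

lemma sum_signed_weight_recurrence:
  assumes "n > 1"
  shows "sum signed_weight (ordered_factorizations n)
    = int (cnum n) - (\<Sum>k | k dvd n \<and> 1 < k \<and> k < n.
        int (cnum k) * sum signed_weight (ordered_factorizations (n div k)))"
proof -
  let ?w = "\<lambda>n. sum signed_weight (ordered_factorizations n)"
  let ?D = "{k. k dvd n \<and> 1 < k}"
  have fin: "finite ?D"
    using assms by (intro finite_subset[OF _ finite_divisors_nat[of n]]) auto
  have "bij_betw (\<lambda>(k, ks). k # ks) (SIGMA k:?D. ordered_factorizations (n div k))
      (ordered_factorizations n)"
    unfolding bij_betw_def
  proof
    show "inj_on (\<lambda>(k, ks). k # ks) (SIGMA k:?D. ordered_factorizations (n div k))"
      by (auto simp: inj_on_def)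
    show "(\<lambda>(k, ks). k # ks) ` (SIGMA k:?D. ordered_factorizations (n div k))
        = ordered_factorizations n"
    proof (intro equalityI subsetI)
      fix ks assume ks: "ks \<in> ordered_factorizations n"
      with assms obtain k ks' where Cons: "ks = k # ks'"
        by (cases ks) (auto simp: ordered_factorizations_def)
      with ks have "(k, ks') \<in> (SIGMA k:?D. ordered_factorizations (n div k))"
        by (auto simp: ordered_factorizations_def)
      then show "ks \<in> (\<lambda>(k, ks). k # ks) ` (SIGMA k:?D. ordered_factorizations (n div k))"
        using Cons by force
    qed (auto simp: ordered_factorizations_def)
  qed
  then have "?w n = (\<Sum>(k, ks)\<in>(SIGMA k:?D. ordered_factorizations (n div k)). signed_weight (k # ks))"
    by (simp add: sum.reindex_bij_betw[symmetric] case_prod_unfold)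
  also have "\<dots> = (\<Sum>k\<in>?D. \<Sum>ks\<in>ordered_factorizations (n div k). signed_weight (k # ks))"
  proof (rule sum.Sigma[symmetric, OF fin], intro ballI)
    fix k assume "k \<in> ?D"
    then have "n div k > 0"
      using assms by (auto simp: div_greater_zero_iff dvd_imp_le)
    then show "finite (ordered_factorizations (n div k))"
      by (rule finite_ordered_factorizations)
  qed
  also have "\<dots> = - (\<Sum>k\<in>?D. int (cnum k) * ?w (n div k))"
    by (simp add: signed_weight_Cons sum_distrib_left sum_negf)
  \<comment> \<open>The divisor \<open>k = n\<close> leaves only the empty list, of weight
    \<open>- 1\<close>, and so produces the term \<open>cnum n\<close>.\<close>
  also have "?D = insert n {k. k dvd n \<and> 1 < k \<and> k < n}"
    using assms by (auto dest: dvd_imp_le)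
  also have "- (\<Sum>k\<in>\<dots>. int (cnum k) * ?w (n div k))
      = int (cnum n) - (\<Sum>k | k dvd n \<and> 1 < k \<and> k < n. int (cnum k) * ?w (n div k))"
    using assms by (simp add: sum_signed_weight_1[simplified])
  finally show ?thesis .
qed

text \<open>Both sides obey the same recurrence, which refers only to values \<open>n div k\<close>
  strictly between \<open>1\<close> and \<open>n\<close>; for prime \<open>n\<close> its sum is
  empty.\<close>

lemma num_primes_eq_sum_signed_weight:
  assumes "n > 1"
  shows "int (num_primes n) = sum signed_weight (ordered_factorizations n)"
  using assms
proof (induction n rule: less_induct)
  case (less n)
  have "int (num_primes (n div k)) = sum signed_weight (ordered_factorizations (n div k))"
    if k: "k dvd n" "1 < k" "k < n" for k
  proof (rule less.IH)
    obtain m where m: "n = k * m"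
      using k(1) by (elim dvdE)
    then have "m \<noteq> 0" "m \<noteq> 1"
      using k less.prems by auto
    then show "n div k < n" "n div k > 1"
      using m k(2) by simp_all
  qed
  then show ?case
    by (simp add: num_primes_recurrence[OF less.prems] sum_signed_weight_recurrence[OF less.prems])
qed

theorem proposition3p5:
  fixes n :: nat
  assumes "n > 1"
  shows "(prime n \<longrightarrow> num_primes n = cnum n) \<and>
    (\<not> prime n \<longrightarrow>
      int (num_primes n) =
        (\<Sum>s = 1..Omega n. \<Sum>ks\<in>factorizations s n.
          (- 1) ^ (s + 1) * (\<Prod>k\<leftarrow>ks. int (cnum k))))"
proof (intro conjI impI)
  assume "prime n"
  then have "{k. k dvd n \<and> 1 < k \<and> k < n} = {}"
    by (auto simp: prime_nat_iff)
  then show "num_primes n = cnum n"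
    using num_primes_recurrence[OF assms] by (simp only: sum.empty diff_zero of_nat_eq_iff)
next
  have "int (num_primes n) = sum signed_weight (\<Union>s\<in>{1..Omega n}. factorizations s n)"
    using num_primes_eq_sum_signed_weight[OF assms] ordered_factorizations_eq_UN[OF assms] by simp
  \<comment> \<open>The union is disjoint because \<open>s\<close> is the length of the
    list.\<close>
  also have "\<dots> = (\<Sum>s = 1..Omega n. sum signed_weight (factorizations s n))"
    using assms finite_factorizations by (intro sum.UNION_disjoint) (auto simp: factorizations_def)
  also have "\<dots> = (\<Sum>s = 1..Omega n. \<Sum>ks\<in>factorizations s n.
      (- 1) ^ (s + 1) * (\<Prod>k\<leftarrow>ks. int (cnum k)))"
    by (intro sum.cong) (auto simp: signed_weight_def factorizations_def)
  finally show "int (num_primes n) = (\<Sum>s = 1..Omega n. \<Sum>ks\<in>factorizations s n.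
      (- 1) ^ (s + 1) * (\<Prod>k\<leftarrow>ks. int (cnum k)))" .
qed

end
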